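(* Let $\alpha: I\to E_1^3$ be a non-lightlike curve and let $\beta$ be a non-lightlike evolute-direction curve of $\alpha$. Then the following are equivalent: (i) $\alpha$ is a helix curve. (ii) $\alpha$ is an involute-donor curve of a slant helix. (iii) An evolute-direction curve of $\alpha$ is a slant helix.
   Context: $E_1^3$ is $\mathbb{R}^3$ with the metric $\langle x,y\rangle=-x_1y_1+x_2y_2+x_3y_3$ and the Lorentz vector product $x\times y=(x_2y_3-x_3y_2,\ x_1y_3-x_3y_1,\ x_2y_1-x_1y_2)$. A vector $x$ is spacelike if $\langle x,x\rangle>0$ or $x=0$, timelike if $\langle x,x\rangle<0$, lightlike if $\langle x,x\rangle=0$ and $x\ne0$. A curve is timelike (spacelike) if all its velocity vectors are; non-lightlike means timelike or spacelike; unit speed means $|\langle\alpha',\alpha'\rangle|=1$. All curves are unit speed Frenet curves, as differentiable as needed. A unit speed non-lightlike curve $\alpha(s)$ has Frenet frame $\{T,N,B\}$ (orthonormal, non-lightlike vectors, $T=\alpha'$), curvature $\kappa$ and torsion $\tau$ with $T'=\kappa N,\ N'=\varepsilon_B\kappa T+\tau B,\ B'=\varepsilon_T\tau N$, where $\varepsilon_Y=\langle Y,Y\rangle=\pm1$ and $\varepsilon_B=-\varepsilon_T\varepsilon_N$; the frame satisfies $B=\varepsilon_T\varepsilon_N T\times N$, $N=\varepsilon_B\varepsilon_T B\times T$, $T=\varepsilon_N\varepsilon_B N\times B$. It is a Frenet curve if $\kappa\neq0$. A spacelike curve is of type 1 if $N$ is timelike (and $T,B$ spacelike), of type 2 if $B$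 is timelike (and $T,N$ spacelike). Let $X=uT+vN+wB$ with $u,v,w$ differentiable and $\varepsilon_Tu^2+\varepsilon_Nv^2+\varepsilon_Bw^2=\pm1$ (constant sign). An $X$-direction curve of $\alpha$ is a curve $\beta$ with tangent $\overline T=X$; $s$ is also arc-length for $\beta$. The Frenet frame, curvature and torsion of $\beta$ are $\{\overline T,\overline N,\overline B\},\overline\kappa,\overline\tau$, with $\overline\kappa\ne0$. $\beta$ is an evolute-direction curve of $\alpha$, and $\alpha$ an involute-donor curve of $\beta$, if $\beta$ is an $X$-direction curve of $\alpha$ and an evolute of $\alpha$ (i.e. $\langle\overline T,T\rangle=0$ and $\overline N=T$); explicitly, $X$ is: $-\cos(\int\tau ds)N+\sin(\int\tau ds)B$ if $\alpha$ is timelike and $X$ spacelike; $-\cosh(\int\tau ds)N+\sinh(\int\tau ds)B$ if $\alpha$ is spacelike of type 1 (resp. type 2) and $X$ timelike (resp. spacelike); $\sinh(\int\tau ds)N-\cosh(\int\tau ds)B$ if $\alpha$ is spacelike of type 1 (resp. type 2) and $X$ spacelike (resp. timelike), with $\int\tau\,ds$ an antiderivative of $\tau$. A (general) helix is a curve for which the ratio of its non-zero curvature to its non-zero torsion is a constant function. A slant helix is a curve whose principal normal vectors make a constant angle with a fixed line (i.e. $\langle N,U\rangle$ is constant for some fixed vector $U\neq0$); the characterization used is that $\frac{\kappa^2}{(\tau^2-\kappa^2)^{3/2}}\left(\frac{\tau}{\kappa}\right)'$ or $\frac{\kappa^2}{(\kappa^2\pm\tau^2)^{3/2}}\left(\frac{\tau}{\kappa}\right)'$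 is constant.
   Formalization: The torsion of α is additionally assumed not to vanish identically; for a plane curve such as (0, cos s, sin s) (ii) and (iii) hold while α is not a helix, since a helix must have non-zero torsion. *)

theory Defs
  imports "HOL-Analysis.Analysis"
begin

text \<open>Minkowski 3-space: \<open>real^3\<close> with the Lorentzian metric below.\<close>

definition lorentz :: "real^3 \<Rightarrow> real^3 \<Rightarrow> real" where
  "lorentz x y = - (x$1 * y$1) + x$2 * y$2 + x$3 * y$3"

definition lorentz_cross :: "real^3 \<Rightarrow> real^3 \<Rightarrow> real^3" where
  "lorentz_cross x y =
     vector [x$2 * y$3 - x$3 * y$2, x$1 * y$3 - x$3 * y$1, x$2 * y$1 - x$1 * y$2]"

definition spacelike :: "real^3 \<Rightarrow> bool" where
  "spacelike x \<longleftrightarrow> lorentz x x > 0 \<or> x = 0"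

definition timelike :: "real^3 \<Rightarrow> bool" where
  "timelike x \<longleftrightarrow> lorentz x x < 0"

definition non_lightlike_on :: "real set \<Rightarrow> (real \<Rightarrow> real^3) \<Rightarrow> bool" where
  "non_lightlike_on I V \<longleftrightarrow> (\<forall>s\<in>I. timelike (V s)) \<or> (\<forall>s\<in>I. spacelike (V s))"

definition causal_sign :: "real^3 \<Rightarrow> real" where
  "causal_sign y = lorentz y y"

text \<open>A curve together with its Frenet apparatus. The frame is carried along because the
  Frenet equations determine it only up to the simultaneous change of sign of the
  principal normal, the binormal and the curvature.\<close>

record frenet_data =
  pos :: "real \<Rightarrow> real^3"
  tangent :: "real \<Rightarrow> real^3"
  normal :: "real \<Rightarrow> real^3"
  binormal :: "real \<Rightarrow> real^3"
  curvature :: "real \<Rightarrow> real"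
  torsion :: "real \<Rightarrow> real"

definition lorentz_frame :: "real^3 \<Rightarrow> real^3 \<Rightarrow> real^3 \<Rightarrow> bool" where
  "lorentz_frame T N B \<longleftrightarrow>
     \<bar>lorentz T T\<bar> = 1 \<and> \<bar>lorentz N N\<bar> = 1 \<and> \<bar>lorentz B B\<bar> = 1 \<and>
     lorentz T N = 0 \<and> lorentz T B = 0 \<and> lorentz N B = 0 \<and>
     causal_sign B = - (causal_sign T * causal_sign N) \<and>
     B = (causal_sign T * causal_sign N) *\<^sub>R lorentz_cross T N \<and>
     N = (causal_sign B * causal_sign T) *\<^sub>R lorentz_cross B T \<and>
     T = (causal_sign N * causal_sign B) *\<^sub>R lorentz_cross N B"

text \<open>A unit speed non-lightlike Frenet curve on \<open>I\<close>. The curvature is only required to be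
  non-zero, not positive: for a spacelike \<open>\<alpha>\<close> with timelike normal, for instance, the
  tangent field \<open>X = - cosh \<theta> N + sinh \<theta> B\<close> with \<open>\<theta>' = \<tau>\<close> has \<open>X' = - \<kappa> cosh \<theta> T\<close>, so its integral
  curve has principal normal \<open>T\<close> only with the curvature \<open>- \<kappa> cosh \<theta>\<close>.\<close>

definition frenet_curve :: "real set \<Rightarrow> frenet_data \<Rightarrow> bool" where
  "frenet_curve I \<alpha> \<longleftrightarrow>
     non_lightlike_on I (tangent \<alpha>) \<and>
     (\<forall>s\<in>I.
        lorentz_frame (tangent \<alpha> s) (normal \<alpha> s) (binormal \<alpha> s) \<and>
        curvature \<alpha> s \<noteq> 0 \<and>
        (pos \<alpha> has_vector_derivative tangent \<alpha> s) (at s within I) \<and>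
        (tangent \<alpha> has_vector_derivative curvature \<alpha> s *\<^sub>R normal \<alpha> s) (at s within I) \<and>
        (normal \<alpha> has_vector_derivative
           (causal_sign (binormal \<alpha> s) * curvature \<alpha> s) *\<^sub>R tangent \<alpha> s
             + torsion \<alpha> s *\<^sub>R binormal \<alpha> s) (at s within I) \<and>
        (binormal \<alpha> has_vector_derivative
           (causal_sign (tangent \<alpha> s) * torsion \<alpha> s) *\<^sub>R normal \<alpha> s) (at s within I))"

definition direction_curve ::
    "real set \<Rightarrow> (real \<Rightarrow> real^3) \<Rightarrow> frenet_data \<Rightarrow> frenet_data \<Rightarrow> bool" where
  "direction_curve I X \<alpha> \<beta> \<longleftrightarrow>
     (\<exists>u v w :: real \<Rightarrow> real.
        u differentiable_on I \<and> v differentiable_on I \<and> w differentiable_on I \<and>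
        (\<forall>s\<in>I. X s = u s *\<^sub>R tangent \<alpha> s + v s *\<^sub>R normal \<alpha> s + w s *\<^sub>R binormal \<alpha> s) \<and>
        (\<exists>\<epsilon>\<in>{1, -1}. \<forall>s\<in>I.
           causal_sign (tangent \<alpha> s) * (u s)\<^sup>2 + causal_sign (normal \<alpha> s) * (v s)\<^sup>2
             + causal_sign (binormal \<alpha> s) * (w s)\<^sup>2 = \<epsilon>)) \<and>
     (\<forall>s\<in>I. tangent \<beta> s = X s)"

definition evolute :: "real set \<Rightarrow> frenet_data \<Rightarrow> frenet_data \<Rightarrow> bool" where
  "evolute I \<alpha> \<beta> \<longleftrightarrow>
     (\<forall>s\<in>I. lorentz (tangent \<beta> s) (tangent \<alpha> s) = 0 \<and> normal \<beta> s = tangent \<alpha> s)"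

text \<open>\<open>evolute_direction_curve I \<alpha> \<beta>\<close>: \<open>\<beta>\<close> is an evolute-direction curve of \<open>\<alpha>\<close>;
  \<open>involute_donor_curve I \<beta> \<alpha>\<close>: \<open>\<alpha>\<close> is an involute-donor curve of \<open>\<beta>\<close>.\<close>

definition evolute_direction_curve :: "real set \<Rightarrow> frenet_data \<Rightarrow> frenet_data \<Rightarrow> bool" where
  "evolute_direction_curve I \<alpha> \<beta> \<longleftrightarrow>
     frenet_curve I \<alpha> \<and> frenet_curve I \<beta> \<and>
     (\<exists>X. direction_curve I X \<alpha> \<beta>) \<and> evolute I \<alpha> \<beta>"

definition involute_donor_curve :: "real set \<Rightarrow> frenet_data \<Rightarrow> frenet_data \<Rightarrow> bool" where
  "involute_donor_curve I \<beta> \<alpha> \<longleftrightarrow> evolute_direction_curve I \<alpha> \<beta>"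

definition helix :: "real set \<Rightarrow> frenet_data \<Rightarrow> bool" where
  "helix I \<alpha> \<longleftrightarrow>
     frenet_curve I \<alpha> \<and> (\<forall>s\<in>I. curvature \<alpha> s \<noteq> 0 \<and> torsion \<alpha> s \<noteq> 0) \<and>
     (\<exists>c. \<forall>s\<in>I. curvature \<alpha> s / torsion \<alpha> s = c)"

text \<open>The axis \<open>U\<close> may have any causal character, including lightlike.\<close>

definition slant_helix :: "real set \<Rightarrow> frenet_data \<Rightarrow> bool" where
  "slant_helix I \<alpha> \<longleftrightarrow>
     frenet_curve I \<alpha> \<and> (\<exists>U. U \<noteq> 0 \<and> (\<exists>c. \<forall>s\<in>I. lorentz (normal \<alpha> s) U = c))"

end

theory Submission imports Defs begin

text \<open>The principal normal of any evolute-direction curve of \<open>\<alpha>\<close> is the tangent \<open>T\<close> of \<open>\<alpha>\<close>, so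
  (ii) and (iii) both say that \<open>\<langle>T, U\<rangle>\<close> is constant for some \<open>U \<noteq> 0\<close>, and Lancret's theorem
  remains. If \<open>\<kappa> = c \<tau>\<close>, then \<open>U = T - c \<epsilon>\<^sub>T B\<close> is constant along \<open>\<alpha>\<close> and \<open>\<langle>T, U\<rangle> = \<epsilon>\<^sub>T\<close>.
  Conversely, differentiating a constant \<open>\<langle>T, U\<rangle> = c\<close> gives \<open>\<langle>N, U\<rangle> = 0\<close>; hence
  \<open>\<langle>B, U\<rangle> = d\<close> is constant, and differentiating \<open>\<langle>N, U\<rangle>\<close> gives \<open>\<epsilon>\<^sub>B \<kappa> c + \<tau> d = 0\<close>. Here \<open>d = 0\<close>
  would force \<open>U = 0\<close>, and \<open>c = 0\<close> would force \<open>\<tau> = 0\<close> everywhere.\<close>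

lemma bounded_bilinear_lorentz: "bounded_bilinear lorentz"
  unfolding bilinear_conv_bounded_bilinear[symmetric]
  by (auto simp: bilinear_def linear_iff lorentz_def algebra_simps)

interpretation lorentz: bounded_bilinear lorentz
  by (rule bounded_bilinear_lorentz)

lemma lorentz_commute: "lorentz x y = lorentz y x"
  by (simp add: lorentz_def mult.commute)

lemma has_vector_derivative_lorentz_const:
  assumes "(f has_vector_derivative f') (at s within I)"
  shows "((\<lambda>t. lorentz (f t) U) has_vector_derivative lorentz f' U) (at s within I)"
  using lorentz.has_vector_derivative[OF assms has_vector_derivative_const[of U]]
  by (simp add: lorentz.zero_right)

text \<open>Cramer's rule: up to the triple product, \<open>b x c\<close>, \<open>c x a\<close>,
  \<open>a x b\<close> form the basis dual to \<open>a\<close>, \<open>b\<close>, \<open>c\<close>.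
  It recovers a vector from its products with a frame.\<close>

lemma lorentz_cross_expansion:
  "lorentz (lorentz_cross a b) c *\<^sub>R x =
     lorentz x a *\<^sub>R lorentz_cross b c + lorentz x b *\<^sub>R lorentz_cross c a
       + lorentz x c *\<^sub>R lorentz_cross a b"
  by (simp add: vec_eq_iff forall_3 lorentz_def lorentz_cross_def vector_3 algebra_simps)

lemma lorentz_frame_orthonormal:
  assumes "lorentz_frame T N B"
  shows "\<bar>causal_sign T\<bar> = 1" "\<bar>causal_sign N\<bar> = 1" "\<bar>causal_sign B\<bar> = 1"
    and "lorentz T N = 0" "lorentz T B = 0" "lorentz N B = 0"
    and "lorentz N T = 0" "lorentz B T = 0" "lorentz B N = 0"
  using assms unfolding lorentz_frame_def causal_sign_def by (metis lorentz_commute)+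

text \<open>Since \<open>B\<close> is a multiple of \<open>T x N\<close> and is not null, the triple
  product of the frame is nonzero, so the expansion above forces \<open>U = 0\<close>.\<close>

lemma lorentz_frame_orthogonal_eq_0:
  assumes fr: "lorentz_frame T N B"
    and "lorentz T U = 0" "lorentz N U = 0" "lorentz B U = 0"
  shows "U = 0"
proof -
  have "lorentz B B \<noteq> 0"
    using lorentz_frame_orthonormal(3)[OF fr] by (auto simp: causal_sign_def)
  moreover have "B = (causal_sign T * causal_sign N) *\<^sub>R lorentz_cross T N"
    using fr unfolding lorentz_frame_def by blast
  ultimately have "lorentz (lorentz_cross T N) B \<noteq> 0"
    by (metis lorentz.scaleR_left scaleR_zero_right)
  then show ?thesis
    using lorentz_cross_expansion[of T N B U] assms by (simp add: lorentz_commute[of U])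
qed

lemma has_vector_derivative_zero_constant_interval:
  fixes f :: "real \<Rightarrow> 'a::real_normed_vector"
  assumes "is_interval I"
    and "\<And>s. s \<in> I \<Longrightarrow> (f has_vector_derivative 0) (at s within I)"
  obtains c where "\<And>s. s \<in> I \<Longrightarrow> f s = c"
proof -
  have "convex I" using assms(1) by (simp add: is_interval_convex)
  moreover have "(f has_derivative (\<lambda>h. 0)) (at s within I)" if "s \<in> I" for s
    using assms(2)[OF that] by (simp add: has_vector_derivative_def)
  ultimately have "\<exists>c. \<forall>s\<in>I. f s = c" by (rule has_derivative_zero_constant)
  then show ?thesis using that by blast
qed

lemma has_vector_derivative_of_constant_on_interval:
  fixes f :: "real \<Rightarrow> 'a::real_normed_vector"
  assumes "is_interval I" and "interior I \<noteq> {}" and "s \<in> I"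
    and "(f has_vector_derivative f') (at s within I)"
    and "\<And>t. t \<in> I \<Longrightarrow> f t = c"
  shows "f' = 0"
proof -
  \<comment> \<open>A connected set that is not a singleton has no isolated points, so derivatives
    within \<open>I\<close> are unique even at its endpoints.\<close>
  have "I \<noteq> {x}" for x using assms(2) by auto
  then have "s islimpt I"
    by (intro connected_imp_perfect is_interval_connected assms(1,3))
  then have "at s within I \<noteq> bot" by (simp add: trivial_limit_within)
  moreover have "(f has_vector_derivative 0) (at s within I)"
    by (rule has_vector_derivative_transform[OF assms(3) _ has_vector_derivative_const[of c]])
       (use assms(5) in auto)
  ultimately have "0 = f'"
    using assms(4) by (rule vector_derivative_unique_within)
  then show ?thesis ..
qed

lemma frenet_curveD:
  assumes "frenet_curve I \<alpha>" and "s \<in> I"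
  shows "lorentz_frame (tangent \<alpha> s) (normal \<alpha> s) (binormal \<alpha> s)"
    and "curvature \<alpha> s \<noteq> 0"
    and "(tangent \<alpha> has_vector_derivative curvature \<alpha> s *\<^sub>R normal \<alpha> s) (at s within I)"
    and "(normal \<alpha> has_vector_derivative
           (causal_sign (binormal \<alpha> s) * curvature \<alpha> s) *\<^sub>R tangent \<alpha> s
             + torsion \<alpha> s *\<^sub>R binormal \<alpha> s) (at s within I)"
    and "(binormal \<alpha> has_vector_derivative
           (causal_sign (tangent \<alpha> s) * torsion \<alpha> s) *\<^sub>R normal \<alpha> s) (at s within I)"
  using assms unfolding frenet_curve_def by blast+

text \<open>\<open><T,T>\<close> has derivative \<open>2 \<kappa> <N,T> = 0\<close>. A single sign
  is needed later, since it enters the axis as a constant coefficient.\<close>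

lemma causal_sign_tangent_constant:
  assumes "is_interval I" and "frenet_curve I \<alpha>"
  obtains e where "\<And>s. s \<in> I \<Longrightarrow> causal_sign (tangent \<alpha> s) = e"
proof (rule has_vector_derivative_zero_constant_interval[OF assms(1)])
  fix s assume s: "s \<in> I"
  note F = frenet_curveD[OF assms(2) s]
  show "((\<lambda>s. causal_sign (tangent \<alpha> s)) has_vector_derivative 0) (at s within I)"
    using lorentz.has_vector_derivative[OF F(3) F(3)] lorentz_frame_orthonormal[OF F(1)]
    by (simp add: causal_sign_def lorentz.scaleR_left lorentz.scaleR_right)
qed (rule that)

lemma causal_sign_binormal_constant:
  assumes "is_interval I" and "frenet_curve I \<alpha>"
  obtains e where "\<And>s. s \<in> I \<Longrightarrow> causal_sign (binormal \<alpha> s) = e"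
proof (rule has_vector_derivative_zero_constant_interval[OF assms(1)])
  fix s assume s: "s \<in> I"
  note F = frenet_curveD[OF assms(2) s]
  show "((\<lambda>s. causal_sign (binormal \<alpha> s)) has_vector_derivative 0) (at s within I)"
    using lorentz.has_vector_derivative[OF F(5) F(5)] lorentz_frame_orthonormal[OF F(1)]
    by (simp add: causal_sign_def lorentz.scaleR_left lorentz.scaleR_right)
qed (rule that)

lemma helix_imp_constant_angle:
  assumes I: "is_interval I" "I \<noteq> {}" and helix: "helix I \<alpha>"
  obtains U c where "U \<noteq> 0" and "\<And>s. s \<in> I \<Longrightarrow> lorentz (tangent \<alpha> s) U = c"
proof -
  have fr: "frenet_curve I \<alpha>" using helix by (simp add: helix_def)
  obtain r where r: "\<And>s. s \<in> I \<Longrightarrow> curvature \<alpha> s = r * torsion \<alpha> s"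
    using helix by (auto simp: helix_def divide_eq_eq)
  obtain e where e: "\<And>s. s \<in> I \<Longrightarrow> causal_sign (tangent \<alpha> s) = e"
    using causal_sign_tangent_constant[OF I(1) fr] by blast
  have e1: "\<bar>e\<bar> = 1"
    using I(2) lorentz_frame_orthonormal(1)[OF frenet_curveD(1)[OF fr]] e by fastforce
  then have ee: "e * e = 1" by (metis abs_mult_self_eq mult_1)
  \<comment> \<open>The derivative of this candidate axis is
    \<open>(\<kappa> - r e e \<tau>) N\<close>, which vanishes because \<open>e * e = 1\<close> and
    \<open>\<kappa> = r \<tau>\<close>.\<close>
  obtain U where U: "\<And>s. s \<in> I \<Longrightarrow> tangent \<alpha> s - (r * e) *\<^sub>R binormal \<alpha> s = U"
  proof (rule has_vector_derivative_zero_constant_interval[OF I(1)])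
    fix s assume s: "s \<in> I"
    note F = frenet_curveD[OF fr s]
    have "((\<lambda>s. tangent \<alpha> s - (r * e) *\<^sub>R binormal \<alpha> s) has_vector_derivative
        curvature \<alpha> s *\<^sub>R normal \<alpha> s - (r * e) *\<^sub>R ((causal_sign (tangent \<alpha> s) * torsion \<alpha> s) *\<^sub>R normal \<alpha> s))
        (at s within I)"
      by (intro has_vector_derivative_diff F(3)
          bounded_linear.has_vector_derivative[OF bounded_linear_scaleR_right F(5)])
    moreover have "r * e * (e * torsion \<alpha> s) = curvature \<alpha> s"
      using ee r[OF s] by (simp add: algebra_simps)
    ultimately show "((\<lambda>s. tangent \<alpha> s - (r * e) *\<^sub>R binormal \<alpha> s) has_vector_derivative 0) (at s within I)"
      using e[OF s] by simp
  qed blast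
  have TU: "lorentz (tangent \<alpha> s) U = e" if "s \<in> I" for s
    using U[OF that, symmetric] e[OF that] lorentz_frame_orthonormal[OF frenet_curveD(1)[OF fr that]]
    by (simp add: causal_sign_def lorentz.diff_right lorentz.scaleR_right)
  have "U \<noteq> 0"
    using TU I(2) e1 by (auto simp: lorentz.zero_right)
  then show ?thesis using TU that by blast
qed

text \<open>The torsion hypothesis excludes plane curves: if the torsion vanishes on
  \<open>I\<close>, then \<open>B\<close> is constant and \<open>U = B\<close> gives
  \<open><T,U> = 0\<close>, yet the curve is no \<open>helix\<close>.\<close>

lemma constant_angle_imp_helix:
  assumes I: "is_interval I" "interior I \<noteq> {}" and fr: "frenet_curve I \<alpha>"
    and tors: "\<exists>s\<in>I. torsion \<alpha> s \<noteq> 0"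
    and U: "U \<noteq> 0" and c: "\<And>s. s \<in> I \<Longrightarrow> lorentz (tangent \<alpha> s) U = c"
  shows "helix I \<alpha>"
proof -
  note F = frenet_curveD[OF fr]
  have N: "lorentz (normal \<alpha> s) U = 0" if s: "s \<in> I" for s
    using has_vector_derivative_of_constant_on_interval
        [OF I s has_vector_derivative_lorentz_const[OF F(3)[OF s]] c] F(2)[OF s]
    by (simp add: lorentz.scaleR_left)
  obtain d where d: "\<And>s. s \<in> I \<Longrightarrow> lorentz (binormal \<alpha> s) U = d"
  proof (rule has_vector_derivative_zero_constant_interval[OF I(1)])
    fix s assume s: "s \<in> I"
    show "((\<lambda>s. lorentz (binormal \<alpha> s) U) has_vector_derivative 0) (at s within I)"
      using has_vector_derivative_lorentz_const[OF F(5)[OF s], of U] N[OF s]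
      by (simp add: lorentz.scaleR_left)
  qed blast
  obtain e where e: "\<And>s. s \<in> I \<Longrightarrow> causal_sign (binormal \<alpha> s) = e"
    using causal_sign_binormal_constant[OF I(1) fr] by blast
  have eq: "e * curvature \<alpha> s * c + torsion \<alpha> s * d = 0" if s: "s \<in> I" for s
    using has_vector_derivative_of_constant_on_interval
        [OF I s has_vector_derivative_lorentz_const[OF F(4)[OF s]] N]
    by (simp add: lorentz.scaleR_left lorentz.add_left c[OF s] d[OF s] e[OF s])
  obtain s0 where s0: "s0 \<in> I" "torsion \<alpha> s0 \<noteq> 0" using tors by blast
  have "\<bar>e\<bar> = 1"
    using lorentz_frame_orthonormal(3)[OF F(1)[OF s0(1)]] e[OF s0(1)] by simp
  then have e0: "e \<noteq> 0" by auto
  \<comment> \<open>If \<open>d = 0\<close>, then \<open>eq\<close> at \<open>s0\<close> gives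
    \<open>c = 0\<close>, and \<open>U\<close> is orthogonal to the whole frame there.\<close>
  have d0: "d \<noteq> 0"
  proof
    assume "d = 0"
    moreover from this have "c = 0" using eq[OF s0(1)] e0 F(2)[OF s0(1)] by simp
    ultimately show False
      using lorentz_frame_orthogonal_eq_0[OF F(1)] s0(1) c N d U by blast
  qed
  then have c0: "c \<noteq> 0" using eq[OF s0(1)] s0(2) by auto
  \<comment> \<open>Nonvanishing spreads from \<open>s0\<close> to all of \<open>I\<close>: a zero
    of the torsion would turn \<open>eq\<close> into \<open>e \<kappa> c = 0\<close>.\<close>
  have tau: "torsion \<alpha> s \<noteq> 0" if "s \<in> I" for s
    using eq[OF that] e0 c0 F(2)[OF that] by auto
  have "curvature \<alpha> s / torsion \<alpha> s = - d / (e * c)" if "s \<in> I" for s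
    using eq[OF that] tau[OF that] e0 c0 by (simp add: field_simps eq_neg_iff_add_eq_0)
  then show ?thesis
    using fr F(2) tau unfolding helix_def by blast
qed

text \<open>The right-hand side does not involve \<open>\<gamma>\<close>, so all evolute-direction
  curves of \<open>\<alpha>\<close> are slant helices or none is.\<close>

lemma evolute_direction_slant_helix_iff:
  assumes "evolute_direction_curve I \<alpha> \<gamma>"
  shows "slant_helix I \<gamma> \<longleftrightarrow> (\<exists>U c. U \<noteq> 0 \<and> (\<forall>s\<in>I. lorentz (tangent \<alpha> s) U = c))"
  using assms by (auto simp: slant_helix_def evolute_direction_curve_def evolute_def)

theorem theorem3p3:
  fixes I :: "real set" and \<alpha> \<beta> :: frenet_data
  assumes "is_interval I" and "interior I \<noteq> {}"
    and "frenet_curve I \<alpha>"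
    and "\<exists>s\<in>I. torsion \<alpha> s \<noteq> 0"
    and "frenet_curve I \<beta>"
    and "evolute_direction_curve I \<alpha> \<beta>"
  shows "(helix I \<alpha> \<longleftrightarrow> (\<exists>\<gamma>. involute_donor_curve I \<gamma> \<alpha> \<and> slant_helix I \<gamma>)) \<and>
         (helix I \<alpha> \<longleftrightarrow> slant_helix I \<beta>)"
proof -
  have "I \<noteq> {}" using assms(4) by blast
  then have "helix I \<alpha> \<longleftrightarrow> (\<exists>U c. U \<noteq> 0 \<and> (\<forall>s\<in>I. lorentz (tangent \<alpha> s) U = c))"
    using helix_imp_constant_angle[OF assms(1)] constant_angle_imp_helix[OF assms(1-4)] by metis
  then have "slant_helix I \<gamma> \<longleftrightarrow> helix I \<alpha>" if "evolute_direction_curve I \<alpha> \<gamma>" for \<gamma>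
    using evolute_direction_slant_helix_iff[OF that] by simp
  \<comment> \<open>In (ii), \<open>\<beta>\<close> itself serves as the witness
    \<open>\<gamma>\<close>.\<close>
  then show ?thesis
    using assms(6) by (auto simp: involute_donor_curve_def)
qed

end
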